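(* Let $\nu\in\mathbb{R}^k$ with $\nu\ge 0$ (entrywise) and $\nu\neq 0$. The system $M\ddot q(t)+D(\nu)\dot q(t)+Kq(t)=0$ is (asymptotically) stable if and only if $(x^H D_{\mathrm{int}}x,\; x^H D_{\mathrm{ext}}(\nu)x)\neq(0,0)$ for every eigenvector $x$ of the quadratic matrix polynomial $Q_\nu(\lambda)=\lambda^2M+\lambda D(\nu)+K$.
   Context: $M,K\in\mathbb{R}^{n\times n}$ are symmetric positive definite. The damping matrix is $D(\nu)=D_{\mathrm{int}}+D_{\mathrm{ext}}(\nu)$, where $D_{\mathrm{int}}\in\mathbb{R}^{n\times n}$ is symmetric positive semidefinite and such that $M,D_{\mathrm{int}},K$ are simultaneously diagonalizable via a congruence transformation (equivalently $D_{\mathrm{int}}M^{-1}K=KM^{-1}D_{\mathrm{int}}$), and $D_{\mathrm{ext}}(\nu)=\sum_{i=1}^k\nu_iD_iD_i^T$ with $D_i\in\mathbb{R}^{n\times r_i}$ given full rank matrices. An eigenvector of $Q_\nu(\lambda)$ is a nonzero $x\in\mathbb{C}^n$ such that $Q_\nu(\lambda_0)x=0$ for some $\lambda_0\in\mathbb{C}$ (then $\lambda_0$ is called an eigenvalue of $Q_\nu(\lambda)$). The system is called (asymptotically) stable if all eigenvalues of $Q_\nu(\lambda)$ have strictly negative real part. $x^H$ denotes the conjugate transpose of $x$. *)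

theory Defs
  imports Complex_Main "Jordan_Normal_Form.DL_Rank"
begin

definition sym_pos_def :: "nat \<Rightarrow> real mat \<Rightarrow> bool" where
  "sym_pos_def n A \<longleftrightarrow> A \<in> carrier_mat n n \<and> transpose_mat A = A \<and>
     (\<forall>x \<in> carrier_vec n. x \<noteq> 0\<^sub>v n \<longrightarrow> 0 < x \<bullet> (A *\<^sub>v x))"

definition sym_pos_semidef :: "nat \<Rightarrow> real mat \<Rightarrow> bool" where
  "sym_pos_semidef n A \<longleftrightarrow> A \<in> carrier_mat n n \<and> transpose_mat A = A \<and>
     (\<forall>x \<in> carrier_vec n. 0 \<le> x \<bullet> (A *\<^sub>v x))"

definition full_rank :: "real mat \<Rightarrow> bool" where
  "full_rank A \<longleftrightarrow> vec_space.rank (dim_row A) A = min (dim_row A) (dim_col A)"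

definition simultaneously_diagonalizable_congruence :: "nat \<Rightarrow> real mat set \<Rightarrow> bool" where
  "simultaneously_diagonalizable_congruence n S \<longleftrightarrow>
     (\<exists>P \<in> carrier_mat n n. invertible_mat P \<and>
        (\<forall>A \<in> S. diagonal_mat (transpose_mat P * A * P)))"

(* The matrices are numbered 0, ..., k - 1 with k = dim_vec nu.  The sum of the matrices
   nu_i D_i D_i^T is written entrywise, since the type mat has no zero element independent
   of the dimensions. *)
definition external_damping ::
  "nat \<Rightarrow> (nat \<Rightarrow> real mat) \<Rightarrow> real vec \<Rightarrow> real mat" where
  "external_damping n D \<nu> =
     mat n n (\<lambda>(p, q). \<Sum>i<dim_vec \<nu>. (\<nu> $ i \<cdot>\<^sub>m (D i * transpose_mat (D i))) $$ (p, q))"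

abbreviation complex_mat :: "real mat \<Rightarrow> complex mat" where
  "complex_mat \<equiv> map_mat complex_of_real"

definition quadratic_matrix_poly ::
  "real mat \<Rightarrow> real mat \<Rightarrow> real mat \<Rightarrow> complex \<Rightarrow> complex mat" where
  "quadratic_matrix_poly M D K z =
     z\<^sup>2 \<cdot>\<^sub>m complex_mat M + z \<cdot>\<^sub>m complex_mat D + complex_mat K"

definition is_eigenpair :: "nat \<Rightarrow> (complex \<Rightarrow> complex mat) \<Rightarrow> complex \<Rightarrow> complex vec \<Rightarrow> bool" where
  "is_eigenpair n Q z x \<longleftrightarrow> x \<in> carrier_vec n \<and> x \<noteq> 0\<^sub>v n \<and> Q z *\<^sub>v x = 0\<^sub>v n"

definition is_eigenvalue :: "nat \<Rightarrow> (complex \<Rightarrow> complex mat) \<Rightarrow> complex \<Rightarrow> bool" where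
  "is_eigenvalue n Q z \<longleftrightarrow> (\<exists>x. is_eigenpair n Q z x)"

definition is_eigenvector :: "nat \<Rightarrow> (complex \<Rightarrow> complex mat) \<Rightarrow> complex vec \<Rightarrow> bool" where
  "is_eigenvector n Q x \<longleftrightarrow> (\<exists>z. is_eigenpair n Q z x)"

(* Stability of the second-order system M q'' + D q' + K q = 0 is defined by its spectrum,
   not by the decay of its solutions. *)
definition asymptotically_stable :: "nat \<Rightarrow> real mat \<Rightarrow> real mat \<Rightarrow> real mat \<Rightarrow> bool" where
  "asymptotically_stable n M D K \<longleftrightarrow>
     (\<forall>z. is_eigenvalue n (quadratic_matrix_poly M D K) z \<longrightarrow> Re z < 0)"

definition hermitian_form :: "real mat \<Rightarrow> complex vec \<Rightarrow> complex" where
  "hermitian_form A x = conjugate x \<bullet> (complex_mat A *\<^sub>v x)"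

end

(* For an eigenpair (z, x), multiplying Q(z) x = 0 by the conjugate transpose of x gives the
   scalar equation m z^2 + d z + k = 0, whose coefficients are the Hermitian forms of M, D, K
   at x: m and k are positive and d is nonnegative.  The roots of such an equation have negative
   real part if and only if d > 0, and d is the sum of two nonnegative forms. *)
theory Submission
  imports Defs
begin

text \<open>Reduces identities between forms to algebra of finite sums. The type is general so that
  it serves the real quadratic forms as well as the complex Hermitian ones. \<open>y\<close> needs
  no dimension, since \<open>scalar_prod\<close> sums up to the dimension of its second
  argument.\<close>

lemma scalar_prod_mult_mat_vec_sum:
  fixes A :: "'a::comm_ring_1 mat"
  assumes "A \<in> carrier_mat n n" "x \<in> carrier_vec n"
  shows "y \<bullet> (A *\<^sub>v x) = (\<Sum>i<n. \<Sum>j<n. y $ i * A $$ (i, j) * x $ j)"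
  using assms
  by (simp add: scalar_prod_def sum_distrib_left mult.assoc lessThan_atLeast0)

lemma hermitian_form_sum:
  assumes "A \<in> carrier_mat n n" "x \<in> carrier_vec n"
  shows "hermitian_form A x =
    (\<Sum>i<n. \<Sum>j<n. cnj (x $ i) * complex_of_real (A $$ (i, j)) * x $ j)"
  using assms
  by (simp add: hermitian_form_def scalar_prod_mult_mat_vec_sum conjugate_vec_def
      conjugate_complex_def)

lemma hermitian_form_add:
  assumes "A \<in> carrier_mat n n" "B \<in> carrier_mat n n" "x \<in> carrier_vec n"
  shows "hermitian_form (A + B) x = hermitian_form A x + hermitian_form B x"
  using assms
  by (simp add: hermitian_form_sum[where n = n] algebra_simps sum.distrib)

text \<open>For x = u + iv the form expands to u^T A u + v^T A v + i (u^T A v - v^T A u), and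
  symmetry of A cancels the imaginary part. This carries definiteness, which is assumed on real
  vectors, over to complex ones.\<close>

lemma hermitian_form_real:
  assumes A: "A \<in> carrier_mat n n" "transpose_mat A = A" and x: "x \<in> carrier_vec n"
  shows "hermitian_form A x = complex_of_real
    (map_vec Re x \<bullet> (A *\<^sub>v map_vec Re x) + map_vec Im x \<bullet> (A *\<^sub>v map_vec Im x))"
proof (rule complex_eqI)
  show "Re (hermitian_form A x) = Re (complex_of_real
    (map_vec Re x \<bullet> (A *\<^sub>v map_vec Re x) + map_vec Im x \<bullet> (A *\<^sub>v map_vec Im x)))"
    using A x
    by (simp add: hermitian_form_sum[where n = n] scalar_prod_mult_mat_vec_sum[where n = n]
        sum.distrib algebra_simps)
  have sym: "A $$ (j, i) = A $$ (i, j)" if "i < n" "j < n" for i j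
    using A that by (metis carrier_matD index_transpose_mat(1))
  \<comment> \<open>The two cross terms agree: exchange the summations, then use the symmetry of
    \<open>A\<close> and rename the indices.\<close>
  have "(\<Sum>i<n. \<Sum>j<n. Re (x $ i) * A $$ (i, j) * Im (x $ j)) =
      (\<Sum>j<n. \<Sum>i<n. Re (x $ i) * A $$ (i, j) * Im (x $ j))"
    by (rule sum.swap)
  also have "\<dots> = (\<Sum>i<n. \<Sum>j<n. Im (x $ i) * A $$ (i, j) * Re (x $ j))"
    by (intro sum.cong refl) (simp add: sym mult_ac)
  finally show "Im (hermitian_form A x) = Im (complex_of_real
    (map_vec Re x \<bullet> (A *\<^sub>v map_vec Re x) + map_vec Im x \<bullet> (A *\<^sub>v map_vec Im x)))"
    using A x
    by (simp add: hermitian_form_sum[where n = n] sum_subtractf algebra_simps)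
qed

text \<open>The form is complex-valued, so its sign is expressed through a real witness; these
  witnesses become the real coefficients in \<open>Re_quadratic_root_neg_iff\<close>.\<close>

lemma hermitian_form_nonneg:
  assumes "sym_pos_semidef n A" "x \<in> carrier_vec n"
  obtains a where "0 \<le> a" "hermitian_form A x = complex_of_real a"
proof -
  have "map_vec Re x \<in> carrier_vec n" "map_vec Im x \<in> carrier_vec n"
    using assms(2) by auto
  with assms that show thesis
    unfolding sym_pos_semidef_def
    by (metis add_nonneg_nonneg hermitian_form_real)
qed

lemma sym_pos_def_imp_semidef:
  assumes "sym_pos_def n A"
  shows "sym_pos_semidef n A"
proof -
  have "0 \<le> x \<bullet> (A *\<^sub>v x)" if "x \<in> carrier_vec n" for x
    using assms that by (cases "x = 0\<^sub>v n") (auto simp: sym_pos_def_def intro: less_imp_le)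
  then show ?thesis
    using assms by (auto simp: sym_pos_def_def sym_pos_semidef_def)
qed

lemma hermitian_form_pos:
  assumes A: "sym_pos_def n A" and x: "x \<in> carrier_vec n" "x \<noteq> 0\<^sub>v n"
  obtains a where "0 < a" "hermitian_form A x = complex_of_real a"
proof -
  let ?u = "map_vec Re x" and ?v = "map_vec Im x"
  have uv: "?u \<in> carrier_vec n" "?v \<in> carrier_vec n"
    using x by auto
  \<comment> \<open>One nonzero part suffices: its summand is strictly positive while the other is
    at least nonnegative.\<close>
  have "?u \<noteq> 0\<^sub>v n \<or> ?v \<noteq> 0\<^sub>v n"
  proof (rule ccontr)
    assume "\<not> (?u \<noteq> 0\<^sub>v n \<or> ?v \<noteq> 0\<^sub>v n)"
    then have "?u $ i = 0 \<and> ?v $ i = 0" if "i < n" for i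
      using that by simp
    then have "x = 0\<^sub>v n"
      using x by (intro eq_vecI) (auto simp: complex_eq_iff)
    with x show False by simp
  qed
  moreover have "0 \<le> w \<bullet> (A *\<^sub>v w)" if "w \<in> carrier_vec n" for w
    using sym_pos_def_imp_semidef[OF A] that by (simp add: sym_pos_semidef_def)
  moreover have "0 < w \<bullet> (A *\<^sub>v w)" if "w \<in> carrier_vec n" "w \<noteq> 0\<^sub>v n" for w
    using A that by (simp add: sym_pos_def_def)
  ultimately have "0 < ?u \<bullet> (A *\<^sub>v ?u) + ?v \<bullet> (A *\<^sub>v ?v)"
    using uv by (meson add_pos_nonneg add_nonneg_pos)
  then show thesis
    by (rule that) (use A x in \<open>simp only: sym_pos_def_def hermitian_form_real[where n = n]\<close>)
qed

text \<open>The quadratic form at x is the sum of nu_i |D_i^T x|^2, and the weights nu_i are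
  nonnegative.\<close>

lemma sym_pos_semidef_external_damping:
  assumes D: "\<And>i. i < dim_vec \<nu> \<Longrightarrow> D i \<in> carrier_mat n (r i)"
    and \<nu>: "\<And>i. i < dim_vec \<nu> \<Longrightarrow> 0 \<le> \<nu> $ i"
  shows "sym_pos_semidef n (external_damping n D \<nu>)"
proof -
  let ?E = "external_damping n D \<nu>"
  have E: "?E \<in> carrier_mat n n"
    by (simp add: external_damping_def)
  have entry: "?E $$ (p, q) = (\<Sum>i<dim_vec \<nu>. \<Sum>l<r i. \<nu> $ i * (D i $$ (p, l) * D i $$ (q, l)))"
    if "p < n" "q < n" for p q
    unfolding external_damping_def using that
  proof (simp, intro sum.cong refl)
    fix i assume "i \<in> {..<dim_vec \<nu>}"
    then have "D i \<in> carrier_mat n (r i)" using D by simp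
    then show "(\<nu> $ i \<cdot>\<^sub>m (D i * (D i)\<^sup>T)) $$ (p, q) =
        (\<Sum>l<r i. \<nu> $ i * (D i $$ (p, l) * D i $$ (q, l)))"
      using that by (simp add: scalar_prod_def sum_distrib_left lessThan_atLeast0)
  qed
  have sym: "transpose_mat ?E = ?E"
    using E by (intro eq_matI) (auto simp: entry mult.commute)
  have "0 \<le> x \<bullet> (?E *\<^sub>v x)" if x: "x \<in> carrier_vec n" for x
  proof -
    have "x \<bullet> (?E *\<^sub>v x) = (\<Sum>p<n. \<Sum>q<n. \<Sum>i<dim_vec \<nu>. \<Sum>l<r i.
        \<nu> $ i * ((x $ p * D i $$ (p, l)) * (x $ q * D i $$ (q, l))))"
      unfolding scalar_prod_mult_mat_vec_sum[OF E x]
      by (intro sum.cong refl) (simp add: entry sum_distrib_left sum_distrib_right mult_ac)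
    also have "\<dots> = (\<Sum>i<dim_vec \<nu>. \<Sum>l<r i. \<Sum>p<n. \<Sum>q<n.
        \<nu> $ i * ((x $ p * D i $$ (p, l)) * (x $ q * D i $$ (q, l))))"
      \<comment> \<open>The instantiations fix a direction: sums over \<open>i\<close> and
        \<open>l\<close> only move outward past sums over \<open>{..<n}\<close>, so the rewriting
        terminates.\<close>
      by (simp only: sum.swap[of _ "{..<dim_vec \<nu>}" "{..<n}"] sum.swap[of _ "{..<r _}" "{..<n}"])
    \<comment> \<open>The sum being squared is entry \<open>l\<close> of D_i^T x.\<close>
    also have "\<dots> = (\<Sum>i<dim_vec \<nu>. \<Sum>l<r i. \<nu> $ i * (\<Sum>p<n. x $ p * D i $$ (p, l))\<^sup>2)"
      unfolding power2_eq_square sum_product by (simp only: sum_distrib_left)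
    also have "\<dots> \<ge> 0"
      using \<nu> by (intro sum_nonneg) simp
    finally show ?thesis .
  qed
  with E sym show ?thesis
    by (simp add: sym_pos_semidef_def)
qed

lemma eigenpair_scalar_equation:
  assumes carr: "M \<in> carrier_mat n n" "D \<in> carrier_mat n n" "K \<in> carrier_mat n n"
    and eig: "is_eigenpair n (quadratic_matrix_poly M D K) z x"
  shows "z\<^sup>2 * hermitian_form M x + z * hermitian_form D x + hermitian_form K x = 0"
proof -
  let ?Q = "quadratic_matrix_poly M D K z"
  have x: "x \<in> carrier_vec n" and Qx: "?Q *\<^sub>v x = 0\<^sub>v n"
    using eig by (simp_all add: is_eigenpair_def)
  have Q: "?Q \<in> carrier_mat n n"
    using carr by (simp add: quadratic_matrix_poly_def)
  have "0 = conjugate x \<bullet> (?Q *\<^sub>v x)"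
    using x by (simp add: Qx)
  also have "\<dots> = (\<Sum>i<n. \<Sum>j<n. cnj (x $ i) * ?Q $$ (i, j) * x $ j)"
    using x by (simp add: scalar_prod_mult_mat_vec_sum[OF Q] conjugate_vec_def
        conjugate_complex_def)
  also have "\<dots> = z\<^sup>2 * hermitian_form M x + z * hermitian_form D x + hermitian_form K x"
    using carr x
    by (simp add: hermitian_form_sum[where n = n] quadratic_matrix_poly_def sum_distrib_left
        sum.distrib algebra_simps)
  finally show ?thesis by simp
qed

lemma Re_quadratic_root_neg_iff:
  fixes m d k :: real and z :: complex
  assumes "0 < m" "0 \<le> d" "0 < k"
    and root: "z\<^sup>2 * complex_of_real m + z * complex_of_real d + complex_of_real k = 0"
  shows "Re z < 0 \<longleftrightarrow> 0 < d"
proof -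
  have re: "((Re z)\<^sup>2 - (Im z)\<^sup>2) * m + Re z * d + k = 0"
    using arg_cong[OF root, of Re] by (simp add: power2_eq_square)
  have im: "Im z * (2 * m * Re z + d) = 0"
    using arg_cong[OF root, of Im] by (simp add: power2_eq_square algebra_simps)
  show ?thesis
  proof (cases "Im z = 0")
    \<comment> \<open>For a real root both sides of the equivalence hold: the product of
      \<open>Re z\<close> and \<open>d\<close> is negative, and \<open>d\<close> is
      nonnegative.\<close>
    case True
    with re have "(Re z)\<^sup>2 * m + k = - (Re z * d)" by simp
    moreover have "0 < (Re z)\<^sup>2 * m + k"
      using assms by (intro add_nonneg_pos) simp_all
    ultimately have "Re z * d < 0" by simp
    with \<open>0 \<le> d\<close> show ?thesis
      by (auto simp: mult_less_0_iff)
  next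
    \<comment> \<open>Cancelling \<open>Im z\<close> in \<open>im\<close> fixes the real part of the
      root as -d / (2m).\<close>
    case False
    with im have "d = - (2 * m * Re z)" by simp
    with \<open>0 < m\<close> show ?thesis
      by (simp add: mult_less_0_iff)
  qed
qed

theorem theorem1:
  fixes n k :: nat
    and M K D\<^sub>i\<^sub>n\<^sub>t :: "real mat"
    and r :: "nat \<Rightarrow> nat"
    and D :: "nat \<Rightarrow> real mat"
    and \<nu> :: "real vec"
  assumes "sym_pos_def n M"
    and "sym_pos_def n K"
    and "sym_pos_semidef n D\<^sub>i\<^sub>n\<^sub>t"
    and "simultaneously_diagonalizable_congruence n {M, D\<^sub>i\<^sub>n\<^sub>t, K}"
    and "\<And>i. i < k \<Longrightarrow> D i \<in> carrier_mat n (r i)"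
    and "\<And>i. i < k \<Longrightarrow> full_rank (D i)"
    and "\<nu> \<in> carrier_vec k"
    and "\<And>i. i < k \<Longrightarrow> 0 \<le> \<nu> $ i"
    and "\<nu> \<noteq> 0\<^sub>v k"
  shows "asymptotically_stable n M (D\<^sub>i\<^sub>n\<^sub>t + external_damping n D \<nu>) K \<longleftrightarrow>
    (\<forall>x. is_eigenvector n (quadratic_matrix_poly M (D\<^sub>i\<^sub>n\<^sub>t + external_damping n D \<nu>) K) x \<longrightarrow>
      (hermitian_form D\<^sub>i\<^sub>n\<^sub>t x, hermitian_form (external_damping n D \<nu>) x) \<noteq> (0, 0))"
proof -
  let ?E = "external_damping n D \<nu>"
  let ?Q = "quadratic_matrix_poly M (D\<^sub>i\<^sub>n\<^sub>t + ?E) K"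
  have E: "sym_pos_semidef n ?E"
    using assms by (intro sym_pos_semidef_external_damping) auto
  have carr: "M \<in> carrier_mat n n" "K \<in> carrier_mat n n"
    "D\<^sub>i\<^sub>n\<^sub>t \<in> carrier_mat n n" "?E \<in> carrier_mat n n"
    using assms E by (simp_all add: sym_pos_def_def sym_pos_semidef_def)
  \<comment> \<open>Proved for each eigenpair separately. The left side depends only on
    \<open>z\<close> and the right side only on \<open>x\<close>, so quantifying over all pairs
    yields both directions of the theorem.\<close>
  have "Re z < 0 \<longleftrightarrow> (hermitian_form D\<^sub>i\<^sub>n\<^sub>t x, hermitian_form ?E x) \<noteq> (0, 0)"
    if eig: "is_eigenpair n ?Q z x" for z x
  proof -
    have x: "x \<in> carrier_vec n" "x \<noteq> 0\<^sub>v n"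
      using eig by (simp_all add: is_eigenpair_def)
    obtain m where m: "0 < m" "hermitian_form M x = complex_of_real m"
      using hermitian_form_pos[OF assms(1) x] .
    obtain c where c: "0 < c" "hermitian_form K x = complex_of_real c"
      using hermitian_form_pos[OF assms(2) x] .
    obtain d where d: "0 \<le> d" "hermitian_form D\<^sub>i\<^sub>n\<^sub>t x = complex_of_real d"
      using hermitian_form_nonneg[OF assms(3) x(1)] .
    obtain e where e: "0 \<le> e" "hermitian_form ?E x = complex_of_real e"
      using hermitian_form_nonneg[OF E x(1)] .
    have "z\<^sup>2 * complex_of_real m + z * complex_of_real (d + e) + complex_of_real c = 0"
      using eigenpair_scalar_equation[OF carr(1) _ carr(2) eig] carr x m c d e
      by (simp add: hermitian_form_add[where n = n])
    then have "Re z < 0 \<longleftrightarrow> 0 < d + e"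
      using m c d e by (intro Re_quadratic_root_neg_iff[of m "d + e" c]) auto
    \<comment> \<open>As \<open>d\<close> and \<open>e\<close> are nonnegative, their sum is
      positive exactly when they are not both zero.\<close>
    with d e show ?thesis by auto
  qed
  then show ?thesis
    by (auto simp: asymptotically_stable_def is_eigenvalue_def is_eigenvector_def)
qed

end
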